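(* Let $D\geq 1$ be an integer and define $$F_{1,D}(x_1,\ldots,x_D):=\det\left(\frac{B_n(x_k)}{n}\right)_{1\leq n\leq D,\ 1\leq k\leq D}\in\mathbb Q[x_1,\ldots,x_D]$$ (row index $n$, column index $k$), where $B_n(x)$ is the $n$-th Bernoulli polynomial. Then $$F_{1,D}(x_1,\ldots,x_D)=\frac{1}{D!}\prod_{1\leq i<j\leq D}(x_j-x_i)\sum_{t=0}^{D}(-1)^t\frac{E_{D,D-t}(x_1,\ldots,x_D)}{t+1},$$ where $E_{D,k}(x_1,\ldots,x_D)$ denotes the $k$-th elementary symmetric polynomial in $x_1,\ldots,x_D$.
   Context: The Bernoulli polynomials $B_n(x)$ are defined by $\frac{z e^{xz}}{e^z-1}=\sum_{n\geq 0}B_n(x)\frac{z^n}{n!}$. The elementary symmetric polynomials are $E_{D,0}=1$, $E_{D,1}=x_1+\cdots+x_D$, ..., $E_{D,k}=\sum_{1\leq i_1<\cdots<i_k\leq D}x_{i_1}\cdots x_{i_k}$, ..., $E_{D,D}=x_1\cdots x_D$. *)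

theory Defs
  imports
    Complex_Main
    "HOL-Library.Poly_Mapping"
    "HOL-Computational_Algebra.Polynomial"
    "HOL-Computational_Algebra.Formal_Power_Series"
    "Jordan_Normal_Form.Determinant"
begin

text \<open>
  The formal power series in \<open>z\<close> considered here have coefficients in the ring \<open>\<rat>[x]\<close>, which is
  not a field.  The factor \<open>z / (e\<^sup>z - 1)\<close> is therefore formed in \<open>\<rat>[[z]]\<close> (where the division
  cancels the common factor \<open>z\<close>) and then mapped to \<open>\<rat>[x][[z]]\<close>.
\<close>

definition fps_lift :: "rat fps \<Rightarrow> rat poly fps" where
  "fps_lift f = Abs_fps (\<lambda>n. [:fps_nth f n:])"

text \<open>\<open>e\<^bsup>xz\<^esup> = \<Sum>\<^sub>n x\<^sup>n z\<^sup>n / n!\<close> and \<open>z e\<^bsup>xz\<^esup> / (e\<^sup>z - 1)\<close>:\<close>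

definition fps_exp_x :: "rat poly fps" where
  "fps_exp_x = Abs_fps (\<lambda>n. monom (1 / fact n) n)"

definition bernoulli_gf :: "rat poly fps" where
  "bernoulli_gf = fps_lift (fps_X / (fps_exp 1 - 1)) * fps_exp_x"

definition bernoulli_poly :: "nat \<Rightarrow> rat poly" where
  "bernoulli_poly n = smult (fact n) (fps_nth bernoulli_gf n)"

lemma fps_lift_mult: "fps_lift (f * g) = fps_lift f * fps_lift g"
proof (rule fps_ext)
  fix n
  have sum_const: "[:\<Sum>i\<in>A. h i:] = (\<Sum>i\<in>A. [:h i:])" if "finite A"
    for A :: "nat set" and h :: "nat \<Rightarrow> rat"
    using that
  proof (induction A rule: finite_induct)
    case (insert a A)
    then show ?case by (simp flip: insert.IH)
  qed simp
  show "fps_nth (fps_lift (f * g)) n = fps_nth (fps_lift f * fps_lift g) n"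
    by (simp add: fps_lift_def fps_mult_nth sum_const mult.commute)
qed

lemma bernoulli_poly_generating_function:
  "fps_lift (fps_exp 1 - 1) * Abs_fps (\<lambda>n. smult (1 / fact n) (bernoulli_poly n))
     = fps_X * fps_exp_x"
proof -
  have nz: "fps_exp 1 - 1 \<noteq> (0 :: rat fps)"
  proof
    assume "fps_exp 1 - 1 = (0 :: rat fps)"
    then have "fps_nth (fps_exp 1 - 1) 1 = (0 :: rat)" by simp
    then show False by simp
  qed
  have sd: "subdegree (fps_exp 1 - 1 :: rat fps) = 1"
    by (rule subdegreeI) auto
  have "(fps_exp 1 - 1 :: rat fps) dvd fps_X"
    using nz sd by (subst fps_dvd_iff) auto
  then have quot: "(fps_exp 1 - 1 :: rat fps) * (fps_X / (fps_exp 1 - 1)) = fps_X"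
    by simp
  have "fps_lift (fps_exp 1 - 1) * bernoulli_gf = fps_lift fps_X * fps_exp_x"
    by (simp add: bernoulli_gf_def quot flip: mult.assoc fps_lift_mult)
  moreover have "fps_lift fps_X = fps_X"
    by (rule fps_ext) (simp add: fps_lift_def fps_X_def)
  moreover have "Abs_fps (\<lambda>n. smult (1 / fact n) (bernoulli_poly n)) = bernoulli_gf"
    by (rule fps_ext) (simp add: bernoulli_poly_def)
  ultimately show ?thesis by simp
qed

text \<open>
  Polynomials over \<open>\<rat>\<close> in the variables \<open>x\<^sub>i\<close>, \<open>i \<in> \<nat>\<close>: finitely supported maps from exponent
  vectors to coefficients, with the convolution product of \<open>Poly_Mapping\<close>.  The ring
  \<open>\<rat>[x\<^sub>1, \<dots>, x\<^sub>D]\<close> is the subring of the polynomials that involve only \<open>x\<^sub>1, \<dots>, x\<^sub>D\<close>.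
\<close>

type_synonym rat_mpoly = "(nat \<Rightarrow>\<^sub>0 nat) \<Rightarrow>\<^sub>0 rat"

definition Const :: "rat \<Rightarrow> rat_mpoly" where
  "Const c = Poly_Mapping.single 0 c"

definition Var :: "nat \<Rightarrow> rat_mpoly" where
  "Var i = Poly_Mapping.single (Poly_Mapping.single i 1) 1"

definition subst_var :: "rat poly \<Rightarrow> nat \<Rightarrow> rat_mpoly" where
  "subst_var p k = poly (map_poly Const p) (Var k)"

definition elem_sym :: "nat \<Rightarrow> nat \<Rightarrow> rat_mpoly" where
  "elem_sym D k = (\<Sum>S | S \<subseteq> {1..D} \<and> card S = k. \<Prod>i\<in>S. Var i)"

text \<open>Matrices are indexed from \<open>0\<close>; the entry at \<open>(r, c)\<close> belongs to \<open>n = r + 1\<close> and \<open>k = c + 1\<close>.\<close>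

definition F1 :: "nat \<Rightarrow> rat_mpoly" where
  "F1 D = det (mat D D (\<lambda>(r, c).
     subst_var (smult (1 / of_nat (r + 1)) (bernoulli_poly (r + 1))) (c + 1)))"

end

theory Submission
  imports Defs
begin

text \<open>
  Put \<open>q\<^sub>0 = 1\<close> and \<open>q\<^sub>n = B\<^sub>n / n\<close>.  As \<open>deg q\<^sub>n = n\<close>, the determinant of the \<open>q\<^sub>n\<close> (\<open>0 \<le> n \<le> D\<close>)
  evaluated at \<open>X, x\<^sub>1, \<dots>, x\<^sub>D\<close> is \<open>1/D!\<close> times the Vandermonde product
  \<open>\<Prod>\<^bsub>k\<^esub> (x\<^sub>k - X) \<cdot> \<Prod>\<^bsub>i<j\<^esub> (x\<^sub>j - x\<^sub>i)\<close>.  Integrate over \<open>X\<close> from \<open>0\<close> to \<open>1\<close>, i.e. apply the linear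
  functional \<open>X\<^sup>t \<mapsto> 1/(t+1)\<close>: since \<open>\<integral> B\<^sub>n = 0\<close> for \<open>n \<ge> 1\<close>, the first column becomes
  \<open>(1, 0, \<dots>, 0)\<close>, which leaves the determinant of the theorem, while the expansion of
  \<open>\<Prod>\<^bsub>k\<^esub> (x\<^sub>k - X)\<close> turns into the sum over elementary symmetric polynomials.
\<close>

section \<open>Evaluation determinants and the Vandermonde product\<close>

text \<open>The matrix factors as coefficients times powers, and the degree bound makes the
  coefficient factor lower triangular.\<close>

lemma det_poly_eval:
  fixes p :: "nat \<Rightarrow> 'a :: comm_ring_1 poly" and x :: "nat \<Rightarrow> 'a"
  assumes deg: "\<And>i. i < n \<Longrightarrow> degree (p i) \<le> i"
  shows "det (mat n n (\<lambda>(i, j). poly (p i) (x j)))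
    = (\<Prod>i<n. coeff (p i) i) * det (mat n n (\<lambda>(i, j). x j ^ i))"
proof -
  define L where "L = mat n n (\<lambda>(i, j). coeff (p i) j)"
  define V where "V = mat n n (\<lambda>(i, j). x j ^ i)"
  have carrier: "L \<in> carrier_mat n n" "V \<in> carrier_mat n n"
    by (simp_all add: L_def V_def)
  have "mat n n (\<lambda>(i, j). poly (p i) (x j)) = L * V"
  proof (rule eq_matI)
    fix i j
    assume "i < dim_row (L * V)" "j < dim_col (L * V)"
    then have ij: "i < n" "j < n" by (simp_all add: L_def V_def)
    have "poly (p i) (x j) = (\<Sum>k\<le>degree (p i). coeff (p i) k * x j ^ k)"
      by (rule poly_altdef)
    also have "\<dots> = (\<Sum>k\<in>{0..<n}. coeff (p i) k * x j ^ k)"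
      using deg[OF ij(1)] ij(1) by (intro sum.mono_neutral_left) (simp_all add: coeff_eq_0 subset_eq)
    finally show "mat n n (\<lambda>(i, j). poly (p i) (x j)) $$ (i, j) = (L * V) $$ (i, j)"
      using ij by (simp add: L_def V_def scalar_prod_def)
  qed (simp_all add: L_def V_def)
  moreover have "det L = (\<Prod>i<n. coeff (p i) i)"
  proof -
    have "det L = prod_list (diag_mat L)"
    proof (rule det_lower_triangular[OF _ carrier(1)])
      fix i j :: nat
      assume "i < j" "j < n"
      then show "L $$ (i, j) = 0"
        using deg[of i] by (simp add: L_def coeff_eq_0)
    qed
    then show ?thesis
      by (simp add: prod_list_diag_prod L_def lessThan_atLeast0)
  qed
  ultimately show ?thesis
    using det_mult[OF carrier] by (simp add: V_def)
qed

lemma coeff_prod_monic_linear: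
  fixes a :: "nat \<Rightarrow> 'a :: comm_ring_1"
  shows "coeff (\<Prod>k<n. [:- a k, 1:]) n = 1"
    and "degree (\<Prod>k<n. [:- a k, 1:]) \<le> n"
proof -
  show deg: "degree (\<Prod>k<n. [:- a k, 1:]) \<le> n" for n
  proof -
    have "degree (\<Prod>k<n. [:- a k, 1:]) \<le> (\<Sum>k<n. degree [:- a k, 1:])"
      by (intro degree_prod_sum_le[unfolded comp_def]) simp
    then show ?thesis by simp
  qed
  show "coeff (\<Prod>k<n. [:- a k, 1:]) n = 1"
  proof (induction n)
    case (Suc n)
    then show ?case
      using deg[of n] by (simp add: coeff_eq_0 mult.commute)
  qed simp
qed

text \<open>In the Newton basis \<open>\<Prod>\<^bsub>k<i\<^esub> (X - x\<^sub>k)\<close> the evaluation matrix is upper triangular.\<close>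

lemma det_vandermonde:
  fixes x :: "nat \<Rightarrow> 'a :: comm_ring_1"
  shows "det (mat n n (\<lambda>(i, j). x j ^ i)) = (\<Prod>j<n. \<Prod>i<j. x j - x i)"
proof -
  define N where "N = (\<lambda>i. \<Prod>k<i. [:- x k, 1:])"
  define A where "A = mat n n (\<lambda>(i, j). poly (N i) (x j))"
  have N_eval: "poly (N i) (x j) = (\<Prod>k<i. x j - x k)" for i j
    by (simp add: N_def poly_prod)
  \<comment> \<open>Each \<open>N i\<close> is monic, so passing from powers to the Newton basis
    leaves the determinant unchanged.\<close>
  have "det A = (\<Prod>i<n. coeff (N i) i) * det (mat n n (\<lambda>(i, j). x j ^ i))"
    unfolding A_def by (rule det_poly_eval) (simp add: N_def coeff_prod_monic_linear)
  moreover have "(\<Prod>i<n. coeff (N i) i) = 1"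
    by (simp add: N_def coeff_prod_monic_linear)
  moreover have "det A = prod_list (diag_mat A)"
  proof (rule det_upper_triangular)
    show "A \<in> carrier_mat n n" by (simp add: A_def)
    have "(\<Prod>k<i. x j - x k) = 0" if "j < i" for i j
      using that by (intro prod_zero bexI[of _ j]) auto
    then show "upper_triangular A"
      by (intro upper_triangularI) (simp add: A_def N_eval)
  qed
  moreover have "prod_list (diag_mat A) = (\<Prod>j<n. \<Prod>i<j. x j - x i)"
    by (simp add: prod_list_diag_prod A_def N_eval lessThan_atLeast0)
  ultimately show ?thesis by simp
qed

section \<open>A linear functional applied to the bordered determinant\<close>

text \<open>\<open>S\<close> collects the factors that contribute \<open>x k\<close>; the remaining
  ones contribute \<open>-X\<close>.\<close>

lemma prod_diff_var:
  fixes x :: "nat \<Rightarrow> 'a :: comm_ring_1"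
  shows "(\<Prod>k<n. [:x k:] - [:0, 1:])
    = (\<Sum>S\<in>Pow {..<n}. monom ((-1) ^ (n - card S) * prod x S) (n - card S))"
proof -
  have minus_X: "(- [:0, 1:]) ^ m = (monom ((-1) ^ m) m :: 'a poly)" for m
    by (induction m) (simp_all add: monom_Suc minus_monom)
  have const: "(\<Prod>k\<in>S. [:x k:]) = [:prod x S:]" for S :: "nat set"
    by (induction S rule: infinite_finite_induct) simp_all
  have "(\<Prod>k<n. [:x k:] - [:0, 1:]) = (\<Prod>k<n. [:x k:] + (- [:0, 1:]))"
    by (simp only: diff_conv_add_uminus)
  also have "\<dots> = (\<Sum>S\<in>Pow {..<n}. (\<Prod>k\<in>S. [:x k:]) * (\<Prod>k\<in>{..<n} - S. - [:0, 1:]))"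
    by (rule prod_add) simp
  also have "\<dots> = (\<Sum>S\<in>Pow {..<n}. monom ((-1) ^ (n - card S) * prod x S) (n - card S))"
  proof (rule sum.cong[OF refl])
    fix S
    assume "S \<in> Pow {..<n}"
    then have "card ({..<n} - S) = n - card S"
      by (simp add: card_Diff_subset finite_subset)
    then show "(\<Prod>k\<in>S. [:x k:]) * (\<Prod>k\<in>{..<n} - S. - [:0, 1:])
        = monom ((-1) ^ (n - card S) * prod x S) (n - card S)"
      unfolding const prod_constant by (simp only: minus_X) (simp add: smult_monom mult.commute)
  qed
  finally show ?thesis .
qed

text \<open>Integration is replaced by any functional with moments \<open>w t\<close>. Its value at
  the bordered determinant is computed twice: by expansion along the first column, and from the
  Vandermonde product.\<close>

lemma det_poly_eval_annihilated:
  fixes p :: "nat \<Rightarrow> 'a :: comm_ring_1 poly" and x w :: "nat \<Rightarrow> 'a"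
  assumes p0: "p 0 = 1" and w0: "w 0 = 1"
    and deg: "\<And>i. i \<le> n \<Longrightarrow> degree (p i) \<le> i"
    and annihilated: "\<And>i. 0 < i \<Longrightarrow> i \<le> n \<Longrightarrow> (\<Sum>t\<le>n. coeff (p i) t * w t) = 0"
  shows "det (mat n n (\<lambda>(i, j). poly (p (Suc i)) (x j)))
    = (\<Prod>i<n. coeff (p (Suc i)) (Suc i)) * (\<Prod>j<n. \<Prod>i<j. x j - x i)
      * (\<Sum>t\<le>n. (-1) ^ t * (w t * (\<Sum>S | S \<subseteq> {..<n} \<and> card S = n - t. prod x S)))"
proof -
  interpret const: comm_ring_hom "\<lambda>c :: 'a. [:c:]"
    by unfold_locales simp_all
  \<comment> \<open>Stopping at \<open>n\<close> is harmless: \<open>J\<close> is used below only on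
    polynomials of degree at most \<open>n\<close>.\<close>
  define J where "J f = (\<Sum>t\<le>n. coeff f t * w t)" for f
  have J_sum: "J (sum f A) = (\<Sum>a\<in>A. J (f a))" for f and A :: "'b set"
    unfolding J_def coeff_sum sum_distrib_right by (rule sum.swap)
  have J_const: "J (f * [:c:]) = J f * c" for f c
    by (simp add: J_def sum_distrib_left mult_ac)
  have J_monom: "J (monom c t) = c * w t" if "t \<le> n" for c t
    using that by (simp add: J_def if_distrib[of "\<lambda>u. u * _"] cong: if_cong)
  \<comment> \<open>The points live in \<open>'a poly\<close>: first the integration variable
    \<open>X\<close>, then the constants \<open>x k\<close>. The coefficients of \<open>p i\<close>
    are lifted accordingly in \<open>P i\<close>.\<close>
  define y where "y j = (case j of 0 \<Rightarrow> [:0, 1:] | Suc k \<Rightarrow> [:x k:])" for j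
  then have y_0: "y 0 = [:0, 1:]" and y_Suc: "y (Suc k) = [:x k:]" for k
    by simp_all
  define P where "P i = map_poly (\<lambda>c. [:c:]) (p i)" for i
  define M where "M = mat (Suc n) (Suc n) (\<lambda>(i, j). poly (P i) (y j))"
  have P_eval: "poly (P i) f = pcompose (p i) f" for i f
    by (simp add: P_def pcompose_altdef)
  have M_0: "M $$ (i, 0) = p i" if "i < Suc n" for i
    using that pcompose_idR[of "p i"] by (simp add: M_def P_eval y_def)
  have poly_const: "poly (map_poly (\<lambda>c. [:c:]) f) [:c:] = [:poly f c:]" for f :: "'a poly" and c
    by (induction f) (simp_all add: map_poly_pCons)
  then have P_const: "poly (P i) [:c:] = [:poly (p i) c:]" for i c
    by (simp add: P_def)

  have "J (det M) = det (mat n n (\<lambda>(i, j). poly (p (Suc i)) (x j)))"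
  proof -
    \<comment> \<open>Deleting row \<open>i\<close> skips \<open>p i\<close>, and deleting column 0
      removes every entry containing \<open>X\<close>, so the cofactors are constants, which pass
      through \<open>J\<close>.\<close>
    define c where "c i = (-1) ^ i * det (mat n n (\<lambda>(r, j). poly (p (if r < i then r else Suc r)) (x j)))"
      for i
    have cof: "cofactor M i 0 = [:c i:]" if "i < Suc n" for i
    proof -
      have "mat_delete M i 0
          = map_mat (\<lambda>c. [:c:]) (mat n n (\<lambda>(r, j). poly (p (if r < i then r else Suc r)) (x j)))"
        using that by (intro eq_matI) (auto simp: mat_delete_def M_def y_def P_const)
      then show ?thesis
        by (simp only: cofactor_def c_def add_0_right const.hom_mult const.hom_power
            const.hom_uminus const.hom_one const.hom_det)
    qed
    have "det M = (\<Sum>i<Suc n. M $$ (i, 0) * cofactor M i 0)"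
      by (rule laplace_expansion_column) (simp_all add: M_def)
    also have "\<dots> = (\<Sum>i<Suc n. p i * [:c i:])"
      by (rule sum.cong[OF refl]) (simp add: M_0 cof del: mult_pCons_right)
    finally have "J (det M) = (\<Sum>i<Suc n. J (p i) * c i)"
      by (simp only: J_sum J_const)
    \<comment> \<open>\<open>J\<close> kills \<open>p i\<close> for \<open>i > 0\<close>, and
      \<open>c 0\<close> is the desired determinant.\<close>
    also have "\<dots> = J (p 0) * c 0"
      unfolding sum.lessThan_Suc_shift using annihilated by (simp add: J_def)
    also have "J (p 0) = 1"
      using J_monom[of 0 1] by (simp add: p0 w0 monom_0)
    finally show ?thesis by (simp add: c_def)
  qed
  moreover have "J (det M) = J (\<Prod>k<n. [:x k:] - [:0, 1:])
    * ((\<Prod>i<n. coeff (p (Suc i)) (Suc i)) * (\<Prod>j<n. \<Prod>i<j. x j - x i))"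
  proof -
    have P_deg: "degree (P i) \<le> i" if "i < Suc n" for i
      unfolding P_def using deg[of i] that
      by (intro order.trans[OF map_poly_degree_leq]) auto
    have "det M = (\<Prod>i<Suc n. coeff (P i) i) * (\<Prod>j<Suc n. \<Prod>i<j. y j - y i)"
      unfolding M_def by (subst det_poly_eval[OF P_deg]) (simp_all add: det_vandermonde)
    also have "(\<Prod>i<Suc n. coeff (P i) i) = [:\<Prod>i<n. coeff (p (Suc i)) (Suc i):]"
      unfolding prod.lessThan_Suc_shift by (simp add: P_def coeff_map_poly p0 const.hom_prod)
    \<comment> \<open>The factors with \<open>i = 0\<close> are \<open>x k - X\<close>; the others
      are constants.\<close>
    also have "(\<Prod>j<Suc n. \<Prod>i<j. y j - y i)
        = (\<Prod>k<n. [:x k:] - [:0, 1:]) * [:\<Prod>j<n. \<Prod>i<j. x j - x i:]"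
      by (simp only: prod.lessThan_Suc_shift y_0 y_Suc const.hom_prod const.hom_minus prod.distrib
          lessThan_0 prod.empty mult_1)
    finally have "det M = (\<Prod>k<n. [:x k:] - [:0, 1:])
        * [:(\<Prod>i<n. coeff (p (Suc i)) (Suc i)) * (\<Prod>j<n. \<Prod>i<j. x j - x i):]"
      by (simp only: const.hom_mult mult_ac)
    then show ?thesis by (simp only: J_const)
  qed
  moreover have "J (\<Prod>k<n. [:x k:] - [:0, 1:])
    = (\<Sum>t\<le>n. (-1) ^ t * (w t * (\<Sum>S | S \<subseteq> {..<n} \<and> card S = n - t. prod x S)))"
  proof -
    have "J (\<Prod>k<n. [:x k:] - [:0, 1:])
        = (\<Sum>S\<in>Pow {..<n}. (-1) ^ (n - card S) * prod x S * w (n - card S))"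
      unfolding prod_diff_var J_sum by (simp add: J_monom)
    \<comment> \<open>Subsets are grouped by the number \<open>t\<close> of factors contributing
      \<open>-X\<close>.\<close>
    also have "\<dots> = (\<Sum>t\<le>n. \<Sum>S | S \<in> Pow {..<n} \<and> n - card S = t.
        (-1) ^ (n - card S) * prod x S * w (n - card S))"
      by (rule sum.group[symmetric]) auto
    also have "\<dots> = (\<Sum>t\<le>n. (-1) ^ t * (w t * (\<Sum>S | S \<subseteq> {..<n} \<and> card S = n - t. prod x S)))"
    proof (rule sum.cong[OF refl])
      fix t
      assume "t \<in> {..n}"
      moreover have "card S \<le> n" if "S \<subseteq> {..<n}" for S
        using card_mono[OF _ that] by simp
      ultimately have "{S \<in> Pow {..<n}. n - card S = t} = {S. S \<subseteq> {..<n} \<and> card S = n - t}"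
        by force
      then show "(\<Sum>S | S \<in> Pow {..<n} \<and> n - card S = t.
            (-1) ^ (n - card S) * prod x S * w (n - card S))
          = (-1) ^ t * (w t * (\<Sum>S | S \<subseteq> {..<n} \<and> card S = n - t. prod x S))"
        using \<open>t \<in> {..n}\<close> by (simp add: sum_distrib_left mult_ac)
    qed
    finally show ?thesis .
  qed
  ultimately show ?thesis by (simp add: mult_ac)
qed

section \<open>Bernoulli polynomials and their integral over [0, 1]\<close>

lemma fps_X_div_exp_minus_1_mult:
  "(fps_X / (fps_exp 1 - 1)) * (fps_exp 1 - 1) = (fps_X :: rat fps)"
proof -
  have sd: "subdegree (fps_exp 1 - 1 :: rat fps) = 1"
    by (rule subdegreeI) auto
  then have "fps_exp 1 - 1 \<noteq> (0 :: rat fps)" by force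
  with sd have "(fps_exp 1 - 1 :: rat fps) dvd fps_X"
    by (subst fps_dvd_iff) auto
  then show ?thesis by simp
qed

text \<open>The series \<open>z/(e^z - 1)\<close> has coefficients \<open>B_m/m!\<close> with
  Bernoulli numbers \<open>B_m\<close>, so the nonzero case is
  \<open>binom(n,k) B_(n-k)\<close>.\<close>

lemma coeff_bernoulli_poly:
  "coeff (bernoulli_poly n) k
    = (if k \<le> n then fact n / fact k * fps_nth (fps_X / (fps_exp 1 - 1)) (n - k) else 0)"
proof -
  have "fps_nth bernoulli_gf n
      = (\<Sum>i\<le>n. smult (fps_nth (fps_X / (fps_exp 1 - 1)) (n - i)) (monom (1 / fact i) i))"
    unfolding bernoulli_gf_def mult.commute[of "fps_lift _"]
    by (simp add: fps_mult_nth fps_lift_def fps_exp_x_def atLeast0AtMost mult.commute)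
  then show ?thesis
    by (simp add: bernoulli_poly_def coeff_sum smult_monom)
qed

text \<open>The left side is the integral of \<open>B_n(x)\<close> over [0, 1]; its value is read
  off at \<open>z^(n+1)\<close> in \<open>z/(e^z - 1) * (e^z - 1) = z\<close>.\<close>

lemma sum_coeff_bernoulli_poly:
  "(\<Sum>t\<le>n. coeff (bernoulli_poly n) t / of_nat (t + 1)) = (if n = 0 then 1 else 0)"
proof -
  let ?b = "fps_X / (fps_exp 1 - 1) :: rat fps"
  have "(if n = 0 then 1 else 0) = fps_nth (?b * (fps_exp 1 - 1)) (Suc n)"
    by (simp add: fps_X_div_exp_minus_1_mult)
  also have "\<dots> = (\<Sum>i\<le>Suc n. fps_nth (fps_exp 1 - 1) i * fps_nth ?b (Suc n - i))"
    by (subst mult.commute) (simp add: fps_mult_nth atLeast0AtMost)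
  \<comment> \<open>The constant term of \<open>e^z - 1\<close> vanishes, so
    \<open>i = t + 1\<close>; the factorial then supplies the weight \<open>1/(t+1)\<close>.\<close>
  also have "\<dots> = (\<Sum>t\<le>n. fps_nth ?b (n - t) / fact (Suc t))"
    unfolding sum.atMost_Suc_shift by (simp del: fact_Suc)
  finally have "fact n * (if n = 0 then 1 else 0)
      = (\<Sum>t\<le>n. fact n * (fps_nth ?b (n - t) / fact (Suc t)))"
    by (simp only: sum_distrib_left)
  also have "\<dots> = (\<Sum>t\<le>n. coeff (bernoulli_poly n) t / of_nat (t + 1))"
    by (rule sum.cong[OF refl]) (simp add: coeff_bernoulli_poly algebra_simps)
  finally show ?thesis by (simp split: if_splits)
qed

lemma coeff_bernoulli_poly_self: "coeff (bernoulli_poly n) n = 1"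
proof -
  \<comment> \<open>Both sides are the constant term of \<open>z/(e^z - 1)\<close>; the integral at
    \<open>n = 0\<close> gives its value.\<close>
  have "coeff (bernoulli_poly n) n = coeff (bernoulli_poly 0) 0"
    by (simp add: coeff_bernoulli_poly)
  also have "\<dots> = 1"
    using sum_coeff_bernoulli_poly[of 0] by simp
  finally show ?thesis .
qed

section \<open>Transfer to polynomials in several variables\<close>

interpretation Const: comm_ring_hom Const
  by unfold_locales (simp_all add: Const_def single_add mult_single flip: single_one)

theorem theorem3p4:
  fixes D :: nat
  assumes "D \<ge> 1"
  shows "F1 D =
    Const (1 / fact D)
    * (\<Prod>(i, j) \<in> {(i, j). 1 \<le> i \<and> i < j \<and> j \<le> D}. Var j - Var i)
    * (\<Sum>t = 0..D. (-1) ^ t * (Const (1 / of_nat (t + 1)) * elem_sym D (D - t)))"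
proof -
  \<comment> \<open>The bordering row needs the constant 1, whereas \<open>B_0/0\<close> would be 0
    by the division convention.\<close>
  define q where "q i = (if i = 0 then 1 else smult (1 / of_nat i) (bernoulli_poly i))" for i
  define w where "w t = Const (1 / of_nat (t + 1))" for t
  have q_deg: "degree (q i) \<le> i" for i
    unfolding q_def by (intro degree_le) (simp add: coeff_bernoulli_poly coeff_eq_0)
  have "det (mat D D (\<lambda>(i, j). poly (map_poly Const (q (Suc i))) (Var (Suc j))))
    = (\<Prod>i<D. coeff (map_poly Const (q (Suc i))) (Suc i))
      * (\<Prod>j<D. \<Prod>i<j. Var (Suc j) - Var (Suc i))
      * (\<Sum>t\<le>D. (-1) ^ t * (w t * (\<Sum>S | S \<subseteq> {..<D} \<and> card S = D - t. \<Prod>i\<in>S. Var (Suc i))))"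
  proof (rule det_poly_eval_annihilated)
    show "map_poly Const (q 0) = 1" "w 0 = 1"
      by (simp_all add: q_def w_def)
    show "degree (map_poly Const (q i)) \<le> i" for i
      using q_deg[of i] by (intro order.trans[OF map_poly_degree_leq]) simp_all
    fix i
    assume i: "0 < i" "i \<le> D"
    have "(\<Sum>t\<le>D. coeff (q i) t / of_nat (t + 1)) = (\<Sum>t\<le>i. coeff (q i) t / of_nat (t + 1))"
      using i q_deg[of i] by (intro sum.mono_neutral_right) (auto intro!: coeff_eq_0)
    also have "\<dots> = (\<Sum>t\<le>i. coeff (bernoulli_poly i) t / of_nat (t + 1)) / of_nat i"
      using i by (simp add: q_def sum_divide_distrib mult.commute)
    also have "\<dots> = 0"
      using i by (simp only: sum_coeff_bernoulli_poly) simp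
    finally have "Const (\<Sum>t\<le>D. coeff (q i) t * (1 / of_nat (t + 1))) = 0"
      by simp
    then show "(\<Sum>t\<le>D. coeff (map_poly Const (q i)) t * w t) = 0"
      by (simp only: Const.hom_sum Const.hom_mult w_def coeff_map_poly Const.hom_zero)
  qed
  moreover have "F1 D = det (mat D D (\<lambda>(i, j). poly (map_poly Const (q (Suc i))) (Var (Suc j))))"
    by (simp add: F1_def subst_var_def q_def)
  moreover have "(\<Prod>i<D. coeff (map_poly Const (q (Suc i))) (Suc i)) = Const (1 / fact D)"
  proof -
    have "(\<Prod>i<D. 1 / of_nat (Suc i)) = (1 / fact D :: rat)"
      by (induction D) (simp_all del: of_nat_Suc)
    then show ?thesis
      by (simp add: coeff_map_poly q_def coeff_bernoulli_poly_self flip: Const.hom_prod)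
  qed
  \<comment> \<open>The reindexing swaps the pair and shifts both indices by one.\<close>
  moreover have "(\<Prod>j<D. \<Prod>i<j. Var (Suc j) - Var (Suc i))
    = (\<Prod>(i, j) \<in> {(i, j). 1 \<le> i \<and> i < j \<and> j \<le> D}. Var j - Var i)"
    unfolding prod.Sigma[OF finite_lessThan, OF ballI, OF finite_lessThan]
    by (rule prod.reindex_bij_witness[of _ "\<lambda>(i, j). (j - 1, i - 1)" "\<lambda>(j, i). (Suc i, Suc j)"]) auto
  moreover have "(\<Sum>S | S \<subseteq> {..<D} \<and> card S = k. \<Prod>i\<in>S. Var (Suc i)) = elem_sym D k" for k
    unfolding elem_sym_def
  proof (rule sum.reindex_bij_witness[of _ "\<lambda>S. (\<lambda>i. i - 1) ` S" "\<lambda>S. Suc ` S"])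
    fix S
    assume "S \<in> {S. S \<subseteq> {1..D} \<and> card S = k}"
    then have S: "S \<subseteq> {1..D}" "card S = k" by auto
    \<comment> \<open>\<open>S\<close> omits 0, so truncated subtraction is injective on it.\<close>
    then have "inj_on (\<lambda>i. i - 1) S"
      by (intro inj_onI) (fastforce simp: subset_iff dest: eq_diff_iff[THEN iffD1, rotated 2])
    then show "(\<lambda>i. i - 1) ` S \<in> {S. S \<subseteq> {..<D} \<and> card S = k}"
      using S by (force simp: card_image)
    have "(\<lambda>i. Suc (i - 1)) ` S = (\<lambda>i. i) ` S"
      using S by (intro image_cong) auto
    then show "Suc ` (\<lambda>i. i - 1) ` S = S"
      by (simp add: image_image)
  next
    fix S
    assume "S \<in> {S. S \<subseteq> {..<D} \<and> card S = k}"
    then show "Suc ` S \<in> {S. S \<subseteq> {1..D} \<and> card S = k}"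
      by (force simp: card_image)
    show "(\<lambda>i. i - 1) ` Suc ` S = S"
      by (simp add: image_image)
    show "(\<Prod>i\<in>Suc ` S. Var i) = (\<Prod>i\<in>S. Var (Suc i))"
      by (simp add: prod.reindex)
  qed
  ultimately show ?thesis
    by (simp only: w_def atLeast0AtMost)
qed

end
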